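(* Let $m,n$ be positive integers and let $K_{m,n}$ be the complete bipartite graph with (labeled) parts of sizes $m$ and $n$. Then \[\mathrm{ic}(K_{m,n}) = \begin{cases} 2 & \text{if } m \text{ or } n \text{ is odd},\\ 2+\binom{m}{m/2}\binom{n}{n/2} & \text{if } m \text{ and } n \text{ are even}.\end{cases}\] If $m$ or $n$ is odd, then $\mathrm{mix}(\mathcal{C}) = mn$ for all $\mathcal{C}\in \mathrm{IC}(K_{m,n})$. If $m$ and $n$ are both even, then exactly two of the colorings in $\mathrm{IC}(K_{m,n})$ have mixing number $mn$, while all the others have mixing number $mn/2$.
   Context: Let $G=(V,E)$ be a finite labeled graph. A coloring of $G$ is an arbitrary map $\mathcal{C}: V \to \{\text{black},\text{white}\}$. An edge is balanced if its endpoints have different colors, and unbalanced otherwise. The mixing number $\mathrm{mix}(\mathcal{C})$ is the number of balanced edges of $G$. For a vertex $v$, $\mathrm{mix}(v)$ is the number of balanced edges incident to $v$. A vertex $v$ is integrated if $\mathrm{mix}(v)\geq \frac12\deg(v)$, and $\mathcal{C}$ is integrated if every vertex is integrated. $\mathrm{IC}(G)$ is the set of all integrated colorings of $G$ and $\mathrm{ic}(G)=|\mathrm{IC}(G)|$. *)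

theory Defs
  imports Complex_Main "HOL-Library.FuncSet"
begin

record 'a graph =
  verts :: "'a set"
  edges :: "'a set set"

definition finite_graph :: "'a graph \<Rightarrow> bool" where
  "finite_graph G \<longleftrightarrow> finite (verts G) \<and> (\<forall>e \<in> edges G. e \<subseteq> verts G \<and> card e = 2)"

datatype color = Black | White

(* Colorings are extensional functions, so that each map from the vertex set to the colors
   is represented by exactly one HOL function and cardinalities count maps on the vertices. *)
definition colorings :: "'a graph \<Rightarrow> ('a \<Rightarrow> color) set" where
  "colorings G = verts G \<rightarrow>\<^sub>E UNIV"

definition balanced :: "('a \<Rightarrow> color) \<Rightarrow> 'a set \<Rightarrow> bool" where
  "balanced C e \<longleftrightarrow> (\<exists>u v. e = {u, v} \<and> C u \<noteq> C v)"

definition mix :: "'a graph \<Rightarrow> ('a \<Rightarrow> color) \<Rightarrow> nat" where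
  "mix G C = card {e \<in> edges G. balanced C e}"

definition mix_at :: "'a graph \<Rightarrow> ('a \<Rightarrow> color) \<Rightarrow> 'a \<Rightarrow> nat" where
  "mix_at G C v = card {e \<in> edges G. v \<in> e \<and> balanced C e}"

definition degree :: "'a graph \<Rightarrow> 'a \<Rightarrow> nat" where
  "degree G v = card {e \<in> edges G. v \<in> e}"

definition integrated_at :: "'a graph \<Rightarrow> ('a \<Rightarrow> color) \<Rightarrow> 'a \<Rightarrow> bool" where
  "integrated_at G C v \<longleftrightarrow> real (mix_at G C v) \<ge> 1 / 2 * real (degree G v)"

definition integrated :: "'a graph \<Rightarrow> ('a \<Rightarrow> color) \<Rightarrow> bool" where
  "integrated G C \<longleftrightarrow> (\<forall>v \<in> verts G. integrated_at G C v)"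

definition IC :: "'a graph \<Rightarrow> ('a \<Rightarrow> color) set" where
  "IC G = {C \<in> colorings G. integrated G C}"

definition ic :: "'a graph \<Rightarrow> nat" where
  "ic G = card (IC G)"

definition complete_bipartite :: "nat \<Rightarrow> nat \<Rightarrow> (nat + nat) graph" where
  "complete_bipartite m n =
     \<lparr>verts = {..<m} <+> {..<n},
      edges = {{Inl i, Inr j} | i j. i < m \<and> j < n}\<rparr>"

lemma finite_graph_complete_bipartite: "finite_graph (complete_bipartite m n)"
  by (auto simp: finite_graph_def complete_bipartite_def)

end

theory Submission imports Defs begin

text \<open>
  Let \<open>p\<close> and \<open>q\<close> be the numbers of black vertices in the parts of sizes \<open>m\<close> and \<open>n\<close>. Each vertex
  sees the whole opposite part and nothing else, so everything in sight depends only on \<open>p\<close>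
  and \<open>q\<close>. The mixing number is \<open>p (n - q) + (m - p) q\<close>. A black vertex on the left is integrated iff
  at most half of the right part is black, a white one iff at least half of it is, and the same
  holds with the sides exchanged. Hence, if the left part contains both colors, the right part is
  split evenly; it then contains both colors too, and the left part is split evenly in turn. If
  instead the left part has a single color, a right vertex of that color would have no balanced
  edge at all; so every right vertex has the other color, and the coloring is one of the two
  proper ones.

  The profiles \<open>(p, q)\<close> of integrated colorings are thus \<open>(0, n)\<close>, \<open>(m, 0)\<close> and, when both
  parts are even, \<open>(m/2, n/2)\<close> (lemma \<open>integrated_iff_profile\<close>). A profile is attained by
  \<open>(m choose p) (n choose q)\<close> colorings (lemma \<open>card_colorings_with_profile\<close>), and the formula for
  the mixing number (lemma \<open>mix_eq_profile\<close>) gives \<open>m n\<close> for the first two profiles and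
  \<open>m n / 2\<close> for the third.
\<close>

section \<open>Black vertices in the two parts\<close>

definition black_left :: "nat \<Rightarrow> (nat + nat \<Rightarrow> color) \<Rightarrow> nat set" where
  "black_left m C = {i. i < m \<and> C (Inl i) = Black}"

definition black_right :: "nat \<Rightarrow> (nat + nat \<Rightarrow> color) \<Rightarrow> nat set" where
  "black_right n C = {j. j < n \<and> C (Inr j) = Black}"

lemma black_left_subset: "black_left m C \<subseteq> {..<m}"
  by (auto simp: black_left_def)

lemma black_right_subset: "black_right n C \<subseteq> {..<n}"
  by (auto simp: black_right_def)

lemma finite_black [simp]: "finite (black_left m C)" "finite (black_right n C)"
  by (auto simp: black_left_def black_right_def)

lemma card_black_left_le: "card (black_left m C) \<le> m"
  using card_mono[OF _ black_left_subset[of m C]] by simp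

lemma card_black_right_le: "card (black_right n C) \<le> n"
  using card_mono[OF _ black_right_subset[of n C]] by simp

lemma card_white_left: "card ({..<m} - black_left m C) = m - card (black_left m C)"
  by (simp add: card_Diff_subset black_left_subset)

lemma card_white_right: "card ({..<n} - black_right n C) = n - card (black_right n C)"
  by (simp add: card_Diff_subset black_right_subset)

section \<open>Balanced edges\<close>

lemma balanced_pair: "balanced C {u, v} \<longleftrightarrow> C u \<noteq> C v"
  by (auto simp: balanced_def doubleton_eq_iff)

lemma color_neq_iff: "(c::color) \<noteq> d \<longleftrightarrow> c = Black \<and> d = White \<or> c = White \<and> d = Black"
  by (cases c; cases d) auto

lemma inj_left_edges: "inj_on (\<lambda>j. {Inl i, Inr j}) A"
  by (auto simp: inj_on_def doubleton_eq_iff)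

lemma inj_right_edges: "inj_on (\<lambda>i. {Inl i, Inr j}) A"
  by (auto simp: inj_on_def doubleton_eq_iff)

lemma inj_edges: "inj_on (\<lambda>(i, j). {Inl i, Inr j}) A"
  by (auto simp: inj_on_def doubleton_eq_iff)

lemma mix_eq_profile:
  "mix (complete_bipartite m n) C
     = card (black_left m C) * (n - card (black_right n C))
       + (m - card (black_left m C)) * card (black_right n C)"
proof -
  let ?P = "black_left m C \<times> ({..<n} - black_right n C)"
  let ?Q = "({..<m} - black_left m C) \<times> black_right n C"
  have "{e \<in> edges (complete_bipartite m n). balanced C e}
          = (\<lambda>(i, j). {Inl i, Inr j}) ` (?P \<union> ?Q)" (is "?E = _")
  proof (intro equalityI subsetI)
    fix e assume "e \<in> ?E"
    then obtain i j where "e = {Inl i, Inr j}" "i < m" "j < n" "C (Inl i) \<noteq> C (Inr j)"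
      by (auto simp: complete_bipartite_def balanced_pair)
    then show "e \<in> (\<lambda>(i, j). {Inl i, Inr j}) ` (?P \<union> ?Q)"
      by (intro image_eqI[of _ _ "(i, j)"])
        (auto simp: black_left_def black_right_def color_neq_iff)
  next
    fix e assume "e \<in> (\<lambda>(i, j). {Inl i, Inr j}) ` (?P \<union> ?Q)"
    then show "e \<in> ?E"
      by (auto simp: complete_bipartite_def balanced_pair black_left_def black_right_def)
  qed
  then have "mix (complete_bipartite m n) C = card (?P \<union> ?Q)"
    by (simp add: mix_def card_image[OF inj_edges])
  also have "\<dots> = card ?P + card ?Q"
    by (rule card_Un_disjoint) auto
  finally show ?thesis
    by (simp add: card_cartesian_product card_white_left card_white_right)
qed

lemma degree_left:
  assumes "i < m"
  shows "degree (complete_bipartite m n) (Inl i) = n"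
proof -
  have "{e \<in> edges (complete_bipartite m n). Inl i \<in> e} = (\<lambda>j. {Inl i, Inr j}) ` {..<n}"
    using assms by (auto simp: complete_bipartite_def)
  then show ?thesis
    by (simp add: degree_def card_image[OF inj_left_edges])
qed

lemma degree_right:
  assumes "j < n"
  shows "degree (complete_bipartite m n) (Inr j) = m"
proof -
  have "{e \<in> edges (complete_bipartite m n). Inr j \<in> e} = (\<lambda>i. {Inl i, Inr j}) ` {..<m}"
    using assms by (auto simp: complete_bipartite_def)
  then show ?thesis
    by (simp add: degree_def card_image[OF inj_right_edges])
qed

lemma mix_at_left:
  assumes "i < m"
  shows "mix_at (complete_bipartite m n) C (Inl i)
           = (if C (Inl i) = Black then n - card (black_right n C) else card (black_right n C))"
proof -
  have "{e \<in> edges (complete_bipartite m n). Inl i \<in> e \<and> balanced C e}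
          = (\<lambda>j. {Inl i, Inr j}) ` {j. j < n \<and> C (Inl i) \<noteq> C (Inr j)}"
    using assms by (auto simp: complete_bipartite_def balanced_pair)
  moreover have "{j. j < n \<and> C (Inl i) \<noteq> C (Inr j)}
          = (if C (Inl i) = Black then {..<n} - black_right n C else black_right n C)"
    by (auto simp: black_right_def color_neq_iff)
  ultimately show ?thesis
    by (simp add: mix_at_def card_image[OF inj_left_edges] card_white_right)
qed

lemma mix_at_right:
  assumes "j < n"
  shows "mix_at (complete_bipartite m n) C (Inr j)
           = (if C (Inr j) = Black then m - card (black_left m C) else card (black_left m C))"
proof -
  have "{e \<in> edges (complete_bipartite m n). Inr j \<in> e \<and> balanced C e}
          = (\<lambda>i. {Inl i, Inr j}) ` {i. i < m \<and> C (Inl i) \<noteq> C (Inr j)}"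
    using assms by (auto simp: complete_bipartite_def balanced_pair)
  moreover have "{i. i < m \<and> C (Inl i) \<noteq> C (Inr j)}
          = (if C (Inr j) = Black then {..<m} - black_left m C else black_left m C)"
    by (auto simp: black_left_def color_neq_iff)
  ultimately show ?thesis
    by (simp add: mix_at_def card_image[OF inj_right_edges] card_white_left)
qed

section \<open>Integrated colorings\<close>

lemma integrated_at_left_iff:
  assumes "i < m"
  shows "integrated_at (complete_bipartite m n) C (Inl i) \<longleftrightarrow>
           (if C (Inl i) = Black then 2 * card (black_right n C) \<le> n
            else n \<le> 2 * card (black_right n C))"
  using card_black_right_le[of n C]
  by (auto simp: integrated_at_def mix_at_left[OF assms] degree_left[OF assms] of_nat_diff)

lemma integrated_at_right_iff:
  assumes "j < n"
  shows "integrated_at (complete_bipartite m n) C (Inr j) \<longleftrightarrow>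
           (if C (Inr j) = Black then 2 * card (black_left m C) \<le> m
            else m \<le> 2 * card (black_left m C))"
  using card_black_left_le[of m C]
  by (auto simp: integrated_at_def mix_at_right[OF assms] degree_right[OF assms] of_nat_diff)

lemma ex_black_left_iff: "(\<exists>i<m. C (Inl i) = Black) \<longleftrightarrow> 0 < card (black_left m C)"
  by (auto simp: card_gt_0_iff) (auto simp: black_left_def)

lemma ex_black_right_iff: "(\<exists>j<n. C (Inr j) = Black) \<longleftrightarrow> 0 < card (black_right n C)"
  by (auto simp: card_gt_0_iff) (auto simp: black_right_def)

lemma ex_white_left_iff: "(\<exists>i<m. C (Inl i) \<noteq> Black) \<longleftrightarrow> card (black_left m C) < m"
proof -
  have "card (black_left m C) < m \<longleftrightarrow> 0 < card ({..<m} - black_left m C)"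
    by (simp add: card_white_left)
  also have "\<dots> \<longleftrightarrow> {..<m} - black_left m C \<noteq> {}"
    by (simp only: card_gt_0_iff) simp
  finally show ?thesis
    by (auto simp: black_left_def)
qed

lemma ex_white_right_iff: "(\<exists>j<n. C (Inr j) \<noteq> Black) \<longleftrightarrow> card (black_right n C) < n"
proof -
  have "card (black_right n C) < n \<longleftrightarrow> 0 < card ({..<n} - black_right n C)"
    by (simp add: card_white_right)
  also have "\<dots> \<longleftrightarrow> {..<n} - black_right n C \<noteq> {}"
    by (simp only: card_gt_0_iff) simp
  finally show ?thesis
    by (auto simp: black_right_def)
qed

text \<open>
  Whether all vertices are integrated is decided by four implications between inequalities in \<open>p\<close>
  and \<open>q\<close>, one for each part and color. Nonempty parts are essential: they make an even split use
  both colors, so that it forces an even split of the opposite part, and they ensure that a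
  monochromatic part constrains the other one.
\<close>

lemma integrated_iff_profile:
  assumes "m > 0" and "n > 0"
  defines "p \<equiv> \<lambda>C. card (black_left m C)" and "q \<equiv> \<lambda>C. card (black_right n C)"
  shows "integrated (complete_bipartite m n) C \<longleftrightarrow>
           p C = 0 \<and> q C = n \<or> p C = m \<and> q C = 0 \<or> 2 * p C = m \<and> 2 * q C = n"
proof -
  have le: "p C \<le> m" "q C \<le> n"
    by (simp_all add: p_def q_def card_black_left_le card_black_right_le)
  have "integrated (complete_bipartite m n) C \<longleftrightarrow>
          (\<forall>i<m. integrated_at (complete_bipartite m n) C (Inl i))
          \<and> (\<forall>j<n. integrated_at (complete_bipartite m n) C (Inr j))"
    by (auto simp: integrated_def complete_bipartite_def)
  also have "\<dots> \<longleftrightarrow>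
          (\<forall>i<m. if C (Inl i) = Black then 2 * q C \<le> n else n \<le> 2 * q C)
          \<and> (\<forall>j<n. if C (Inr j) = Black then 2 * p C \<le> m else m \<le> 2 * p C)"
    by (simp add: p_def q_def integrated_at_left_iff integrated_at_right_iff)
  also have "\<dots> \<longleftrightarrow>
          ((\<exists>i<m. C (Inl i) = Black) \<longrightarrow> 2 * q C \<le> n)
          \<and> ((\<exists>i<m. C (Inl i) \<noteq> Black) \<longrightarrow> n \<le> 2 * q C)
          \<and> ((\<exists>j<n. C (Inr j) = Black) \<longrightarrow> 2 * p C \<le> m)
          \<and> ((\<exists>j<n. C (Inr j) \<noteq> Black) \<longrightarrow> m \<le> 2 * p C)"
    by (auto split: if_splits)
  also have "\<dots> \<longleftrightarrow>
          (0 < p C \<longrightarrow> 2 * q C \<le> n) \<and> (p C < m \<longrightarrow> n \<le> 2 * q C)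
          \<and> (0 < q C \<longrightarrow> 2 * p C \<le> m) \<and> (q C < n \<longrightarrow> m \<le> 2 * p C)"
    by (simp only: ex_black_left_iff ex_white_left_iff ex_black_right_iff ex_white_right_iff
        p_def q_def)
  also have "\<dots> \<longleftrightarrow>
          p C = 0 \<and> q C = n \<or> p C = m \<and> q C = 0 \<or> 2 * p C = m \<and> 2 * q C = n"
    using assms(1,2) le by linarith
  finally show ?thesis .
qed

section \<open>Counting colorings with a given profile\<close>

definition colorings_with_profile :: "nat \<Rightarrow> nat \<Rightarrow> nat \<Rightarrow> nat \<Rightarrow> (nat + nat \<Rightarrow> color) set" where
  "colorings_with_profile m n p q =
     {C \<in> colorings (complete_bipartite m n).
        card (black_left m C) = p \<and> card (black_right n C) = q}"

text \<open>A coloring is the same thing as the pair of its sets of black vertices in the two parts.\<close>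

lemma bij_betw_colorings_with_profile:
  "bij_betw (\<lambda>C. (black_left m C, black_right n C)) (colorings_with_profile m n p q)
     ({A. A \<subseteq> {..<m} \<and> card A = p} \<times> {B. B \<subseteq> {..<n} \<and> card B = q})"
proof -
  define paint where "paint = (\<lambda>(A, B). restrict
      (case_sum (\<lambda>i. if i \<in> A then Black else White) (\<lambda>j. if j \<in> B then Black else White))
      ({..<m} <+> {..<n}))"
  have left: "black_left m (paint (A, B)) = A" if "A \<subseteq> {..<m}" for A B
    using that by (auto simp: black_left_def paint_def split: if_splits)
  have right: "black_right n (paint (A, B)) = B" if "B \<subseteq> {..<n}" for A B
    using that by (auto simp: black_right_def paint_def split: if_splits)
  have "paint (A, B) \<in> colorings (complete_bipartite m n)" for A B
    by (simp add: colorings_def complete_bipartite_def paint_def)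
  moreover have "paint (black_left m C, black_right n C) = C"
    if "C \<in> colorings (complete_bipartite m n)" for C
  proof
    fix x
    have White: "c \<noteq> Black \<Longrightarrow> White = c" for c
      by (cases c) auto
    show "paint (black_left m C, black_right n C) x = C x"
      using that
      by (cases x) (auto simp: paint_def colorings_def complete_bipartite_def
          black_left_def black_right_def PiE_def extensional_def White)
  qed
  ultimately show ?thesis
    using left right black_left_subset[THEN subsetD] black_right_subset[THEN subsetD]
    by (intro bij_betw_byWitness[where f' = paint])
      (auto simp: colorings_with_profile_def)
qed

lemma card_colorings_with_profile:
  "card (colorings_with_profile m n p q) = (m choose p) * (n choose q)"
  using bij_betw_same_card[OF bij_betw_colorings_with_profile[of m n p q]]
  by (simp add: card_cartesian_product n_subsets)

lemma finite_colorings_with_profile: "finite (colorings_with_profile m n p q)"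
  using bij_betw_finite[OF bij_betw_colorings_with_profile[of m n p q]] by simp

section \<open>The integrated colorings of a complete bipartite graph\<close>

theorem theorem2:
  fixes m n :: nat
  assumes "m > 0" and "n > 0"
  defines "K \<equiv> complete_bipartite m n"
  shows "ic K = (if odd m \<or> odd n then 2
                 else 2 + (m choose (m div 2)) * (n choose (n div 2)))
    \<and> (odd m \<or> odd n \<longrightarrow> (\<forall>C \<in> IC K. mix K C = m * n))
    \<and> (even m \<and> even n \<longrightarrow>
          card {C \<in> IC K. mix K C = m * n} = 2
        \<and> (\<forall>C \<in> IC K. mix K C \<noteq> m * n \<longrightarrow> real (mix K C) = real (m * n) / 2))"
proof -
  define proper where
    "proper = colorings_with_profile m n 0 n \<union> colorings_with_profile m n m 0"
  define even_split where
    "even_split = {C \<in> colorings K. 2 * card (black_left m C) = m \<and> 2 * card (black_right n C) = n}"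
  have IC: "IC K = proper \<union> even_split"
    unfolding IC_def proper_def even_split_def colorings_with_profile_def K_def
    by (auto simp: integrated_iff_profile[OF assms(1,2)])
  have mix_proper: "mix K C = m * n" if "C \<in> proper" for C
    using that by (auto simp: proper_def colorings_with_profile_def K_def mix_eq_profile)
  have mix_even_split: "2 * mix K C = m * n" if "C \<in> even_split" for C
  proof -
    define p q where "p = card (black_left m C)" and "q = card (black_right n C)"
    have "m = 2 * p" "n = 2 * q"
      using that by (auto simp: even_split_def p_def q_def)
    moreover have "mix K C = p * (n - q) + (m - p) * q"
      by (simp add: K_def mix_eq_profile p_def q_def)
    ultimately show ?thesis by simp
  qed
  have card_proper: "card proper = 2"
    unfolding proper_def using assms(1)
    by (subst card_Un_disjoint)
      (auto simp: finite_colorings_with_profile card_colorings_with_profile,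
       auto simp: colorings_with_profile_def)
  have finite_proper: "finite proper"
    by (simp add: proper_def finite_colorings_with_profile)
  \<comment> \<open>The mixing numbers \<open>m n\<close> and \<open>m n / 2\<close> differ because \<open>m n > 0\<close>.\<close>
  have disjoint: "proper \<inter> even_split = {}"
    using mix_proper mix_even_split assms(1,2) by fastforce
  show ?thesis
  proof (cases "odd m \<or> odd n")
    case True
    then have "even_split = {}"
      unfolding even_split_def by (metis (mono_tags, lifting) dvd_triv_left empty_Collect_eq)
    then show ?thesis
      using True IC card_proper mix_proper by (auto simp: ic_def)
  next
    case False
    have "even_split = colorings_with_profile m n (m div 2) (n div 2)"
      using False by (auto simp: even_split_def colorings_with_profile_def K_def)
    then have "ic K = 2 + (m choose (m div 2)) * (n choose (n div 2))"
      using disjoint finite_proper card_proper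
      by (simp add: ic_def IC card_Un_disjoint card_colorings_with_profile
          finite_colorings_with_profile)
    moreover have "{C \<in> IC K. mix K C = m * n} = proper"
      using IC mix_proper mix_even_split assms(1,2) by fastforce
    moreover have "real (mix K C) = real (m * n) / 2"
      if "C \<in> IC K" "mix K C \<noteq> m * n" for C
    proof -
      have "2 * mix K C = m * n"
        using that IC mix_proper mix_even_split by blast
      then have "real (2 * mix K C) = real (m * n)"
        by (simp only:)
      then show ?thesis by simp
    qed
    ultimately show ?thesis
      using False card_proper by simp
  qed
qed

end
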